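(* Let $k,t$ be integers with $k=t^2\ge 9$, and let $H$ be a subgraph of the star $K_{1,k-2}$ with $|E(H)|\ge 4$. Then $$\operatorname{bi-GM}_{k-2}(P_4:H)=t^2(t-1)^2-6(t-1).$$
   Context: All graphs are finite, simple and without isolated vertices. $P_n$ is the path on $n$ vertices; $K_{m,n}$ is the complete bipartite graph. A $k$-edge-coloring of a graph is a map from its edge set onto $\{1,\dots,k\}$ that is exact, i.e. every one of the $k$ colors is used at least once. An edge-colored graph is rainbow if all its edges have distinct colors and monochromatic if all its edges have the same color. A copy of a graph $F$ in a graph $G$ is a subgraph of $G$ isomorphic to $F$; distinct copies are distinct subgraphs. For non-empty bipartite graphs $G,H$ and a positive integer $k$, the bipartite Gallai-Ramsey number $\operatorname{bgr}_k(G:H)$ is the minimum integer $N$ such that for all $n\ge N$, every (exact) $k$-edge-coloring of $K_{n,n}$ contains a rainbow copy of $G$ or a monochromatic copy of $H$. The bipartite Gallai-Ramsey multiplicity $\operatorname{bi-GM}_k(G:H)$ is the minimum, over all (exact) $k$-edge-colorings of $K_{N,N}$ with $N=\operatorname{bgr}_k(G:H)$, of the total number of rainbow copies of $G$ plus monochromatic copies of $H$.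
   Formalization: The bipartite Gallai-Ramsey number is the least N for which K_{N,N} also admits an exact k-edge-coloring (otherwise N=1 qualifies vacuously and the multiplicity is a minimum over an empty set), and t is a nonnegative integer (the formula fails for negative t). *)

theory Defs
  imports Main
begin

type_synonym 'a graph = "'a set \<times> 'a set set"

abbreviation verts :: "'a graph \<Rightarrow> 'a set" where
  "verts G \<equiv> fst G"

abbreviation edges :: "'a graph \<Rightarrow> 'a set set" where
  "edges G \<equiv> snd G"

(* The last conjunct says that there are no isolated vertices. *)
definition simple_graph :: "'a graph \<Rightarrow> bool" where
  "simple_graph G \<longleftrightarrow>
     finite (verts G) \<and>
     (\<forall>e\<in>edges G. e \<subseteq> verts G \<and> card e = 2) \<and>
     (\<forall>v\<in>verts G. \<exists>e\<in>edges G. v \<in> e)"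

definition subgraph :: "'a graph \<Rightarrow> 'a graph \<Rightarrow> bool" where
  "subgraph F G \<longleftrightarrow> simple_graph F \<and> verts F \<subseteq> verts G \<and> edges F \<subseteq> edges G"

definition isomorphic :: "'a graph \<Rightarrow> 'b graph \<Rightarrow> bool" where
  "isomorphic F G \<longleftrightarrow>
     (\<exists>f. bij_betw f (verts F) (verts G) \<and>
          (\<forall>u\<in>verts F. \<forall>v\<in>verts F. {u, v} \<in> edges F \<longleftrightarrow> {f u, f v} \<in> edges G))"

definition path_graph :: "nat \<Rightarrow> nat graph" where
  "path_graph n = ({..<n}, {{i, Suc i} | i. Suc i < n})"

definition complete_bipartite :: "nat \<Rightarrow> nat \<Rightarrow> (nat + nat) graph" where
  "complete_bipartite m n =
     (Inl ` {..<m} \<union> Inr ` {..<n}, {{Inl i, Inr j} | i j. i < m \<and> j < n})"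

definition copies :: "'a graph \<Rightarrow> 'b graph \<Rightarrow> 'b graph set" where
  "copies F G = {F'. subgraph F' G \<and> isomorphic F F'}"

(* Colorings are total functions on vertex sets; only their values on edges matter. *)
definition exact_coloring :: "nat \<Rightarrow> 'a graph \<Rightarrow> ('a set \<Rightarrow> nat) \<Rightarrow> bool" where
  "exact_coloring k G c \<longleftrightarrow> c ` edges G = {1..k}"

definition rainbow :: "('a set \<Rightarrow> nat) \<Rightarrow> 'a graph \<Rightarrow> bool" where
  "rainbow c F \<longleftrightarrow> inj_on c (edges F)"

definition monochromatic :: "('a set \<Rightarrow> nat) \<Rightarrow> 'a graph \<Rightarrow> bool" where
  "monochromatic c F \<longleftrightarrow> (\<forall>e\<in>edges F. \<forall>e'\<in>edges F. c e = c e')"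

(* The first conjunct makes explicit that bgr ranges only over N for which K_{N,N} has an
   exact k-edge-coloring at all, i.e. N^2 >= k. Otherwise small N would qualify vacuously,
   and bi_GM would be a minimum over the empty set. *)
definition bgr :: "nat \<Rightarrow> 'a graph \<Rightarrow> 'b graph \<Rightarrow> nat" where
  "bgr k G H = (LEAST N.
     (\<exists>c. exact_coloring k (complete_bipartite N N) c) \<and>
     (\<forall>n\<ge>N. \<forall>c. exact_coloring k (complete_bipartite n n) c \<longrightarrow>
        (\<exists>F\<in>copies G (complete_bipartite n n). rainbow c F) \<or>
        (\<exists>F\<in>copies H (complete_bipartite n n). monochromatic c F)))"

definition bi_GM :: "nat \<Rightarrow> 'a graph \<Rightarrow> 'b graph \<Rightarrow> nat" where
  "bi_GM k G H =
     (let K = complete_bipartite (bgr k G H) (bgr k G H) in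
      LEAST m. \<exists>c. exact_coloring k K c \<and>
        m = card {F \<in> copies G K. rainbow c F} + card {F \<in> copies H K. monochromatic c F})"

end

theory Submission imports Defs begin

text \<open>
  In \<open>K\<^bsub>n,n\<^esub>\<close> a coloring with at least three colors and without rainbow \<open>P\<^sub>4\<close> is constant on all stars
  around one of the two sides; with \<open>t\<^sup>2 - 2\<close> colors this forces \<open>n \<ge> t\<^sup>2 - 2\<close>, hence a monochromatic
  copy of the star \<open>H\<close>. So the bipartite Gallai-Ramsey number is the least \<open>n\<close> with
  \<open>n\<^sup>2 \<ge> t\<^sup>2 - 2\<close>, which is \<open>t\<close>.

  In an exact \<open>(t\<^sup>2 - 2)\<close>-coloring of \<open>K\<^bsub>t,t\<^esub>\<close> a color class has at most three edges, so no copy of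
  \<open>H\<close> is monochromatic, and at most three pairs of edges are monochromatic. Two
  adjacent edges lie in \<open>2(t - 1)\<close> copies of \<open>P\<^sub>4\<close> and two disjoint ones in only two, so at most
  \<open>6(t - 1)\<close> of the \<open>t\<^sup>2(t - 1)\<^sup>2\<close> copies of \<open>P\<^sub>4\<close> fail to be rainbow. A color class that is a star with
  three edges, all others being singletons, attains this bound.
\<close>

subsection \<open>Copies of \<open>P\<^sub>4\<close> in a complete bipartite graph\<close>

abbreviation bedge :: "nat \<Rightarrow> nat \<Rightarrow> (nat + nat) set" where
  "bedge i j \<equiv> {Inl i, Inr j}"

lemma bedge_eq_iff: "bedge i j = bedge i' j' \<longleftrightarrow> i = i' \<and> j = j'"
  by (auto simp: doubleton_eq_iff)

lemma edges_complete_bipartite: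
  "edges (complete_bipartite m n) = (\<lambda>(i, j). bedge i j) ` ({..<m} \<times> {..<n})"
  by (auto simp: complete_bipartite_def)

lemma inj_bedge: "inj (\<lambda>(i, j). bedge i j)"
  by (auto simp: inj_on_def bedge_eq_iff)

lemma finite_edges_complete_bipartite: "finite (edges (complete_bipartite m n))"
  by (simp add: edges_complete_bipartite)

lemma card_edges_complete_bipartite: "card (edges (complete_bipartite m n)) = m * n"
  by (simp add: edges_complete_bipartite card_image inj_on_subset[OF inj_bedge] del: case_prod_conv)

lemma simple_graph_edgeE:
  assumes "simple_graph F" "e \<in> edges F"
  obtains u v where "e = {u, v}" "u \<in> verts F" "v \<in> verts F" "u \<noteq> v"
  using assms unfolding simple_graph_def by (metis card_2_iff insert_subset)

lemma edges_path_graph_4: "edges (path_graph 4) = {{0, 1}, {1, 2}, {2, 3}}"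
proof -
  have "{{i, Suc i} | i. Suc i < 4} = (\<lambda>i. {i, Suc i}) ` {0, 1, 2}"
    by (auto simp: image_def less_Suc_eq numeral_eq_Suc)
  then show ?thesis
    by (simp add: path_graph_def numeral_eq_Suc)
qed

lemma verts_path_graph_4: "verts (path_graph 4) = {0, 1, 2, 3}"
  by (auto simp: path_graph_def)

text \<open>\<open>isomorphic\<close> only constrains sets \<open>{u, v}\<close> of vertices.
  Simplicity of \<open>F\<close> ensures that all its edges have this shape, so the isomorphism
  determines the whole edge set.\<close>

lemma isomorphic_path_graph_4_iff:
  assumes "simple_graph F"
  shows "isomorphic (path_graph 4) F \<longleftrightarrow>
    (\<exists>a b c d. distinct [a, b, c, d] \<and> F = ({a, b, c, d}, {{a, b}, {b, c}, {c, d}}))"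
proof
  assume "isomorphic (path_graph 4) F"
  then obtain f where bij: "bij_betw f {0, 1, 2, 3::nat} (verts F)"
    and f: "\<forall>u\<in>{0, 1, 2, 3}. \<forall>v\<in>{0, 1, 2, 3}.
      {u, v} \<in> {{0, 1}, {1, 2}, {2, 3}} \<longleftrightarrow> {f u, f v} \<in> edges F"
    unfolding isomorphic_def edges_path_graph_4 verts_path_graph_4 by (elim exE conjE)
  have verts: "verts F = {f 0, f 1, f 2, f 3}"
    using bij by (auto simp: bij_betw_def)
  have dist: "distinct [f 0, f 1, f 2, f 3]"
    using bij by (auto simp: bij_betw_def inj_on_def)
  have "edges F = {{f 0, f 1}, {f 1, f 2}, {f 2, f 3}}"
  proof (intro subset_antisym subsetI)
    fix e assume e: "e \<in> edges F"
    then obtain u v where "e = {u, v}" "u \<in> verts F" "v \<in> verts F"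
      using assms by (auto elim: simple_graph_edgeE)
    moreover have "verts F = f ` {0, 1, 2, 3}"
      using bij by (simp add: bij_betw_def)
    ultimately obtain i j where ij: "e = {f i, f j}" "i \<in> {0, 1, 2, 3}" "j \<in> {0, 1, 2, 3}"
      by (auto simp only: image_iff)
    then have "{i, j} \<in> {{0, 1}, {1, 2}, {2, 3}}"
      using f[rule_format, OF ij(2,3)] e by (simp only:)
    then have "f ` {i, j} \<in> (`) f ` {{0, 1}, {1, 2}, {2, 3}}"
      by (rule imageI)
    then show "e \<in> {{f 0, f 1}, {f 1, f 2}, {f 2, f 3}}"
      by (simp add: ij(1))
  next
    fix e assume "e \<in> {{f 0, f 1}, {f 1, f 2}, {f 2, f 3}}"
    then show "e \<in> edges F"
      using f[rule_format, of 0 1] f[rule_format, of 1 2] f[rule_format, of 2 3] by auto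
  qed
  then show "\<exists>a b c d. distinct [a, b, c, d] \<and> F = ({a, b, c, d}, {{a, b}, {b, c}, {c, d}})"
    using verts dist by (metis prod.collapse)
next
  assume "\<exists>a b c d. distinct [a, b, c, d] \<and> F = ({a, b, c, d}, {{a, b}, {b, c}, {c, d}})"
  then obtain a b c d where dist: "distinct [a, b, c, d]"
    and F: "F = ({a, b, c, d}, {{a, b}, {b, c}, {c, d}})"
    by blast
  define f where "f i = [a, b, c, d] ! i" for i
  have f: "f 0 = a" "f (Suc 0) = b" "f 2 = c" "f 3 = d"
    by (simp_all add: f_def)
  have "bij_betw f (verts (path_graph 4)) (verts F)"
    using dist unfolding verts_path_graph_4 F by (auto simp: bij_betw_def f)
  moreover have "\<forall>u\<in>verts (path_graph 4). \<forall>v\<in>verts (path_graph 4).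
      {u, v} \<in> edges (path_graph 4) \<longleftrightarrow> {f u, f v} \<in> edges F"
    using dist unfolding verts_path_graph_4 edges_path_graph_4 F
    by (simp add: f doubleton_eq_iff) blast
  ultimately show "isomorphic (path_graph 4) F"
    unfolding isomorphic_def by blast
qed

text \<open>A quadruple \<open>(x, y, x', y')\<close> stands for the path \<open>y' - x - y - x'\<close> with middle edge \<open>x - y\<close>,
  where \<open>x\<close>, \<open>x'\<close> are left and \<open>y\<close>, \<open>y'\<close> are right vertices.\<close>

definition quads :: "nat \<Rightarrow> (nat \<times> nat \<times> nat \<times> nat) set" where
  "quads n = (SIGMA x:{..<n}. SIGMA y:{..<n}. ({..<n} - {x}) \<times> ({..<n} - {y}))"

definition p4 :: "nat \<times> nat \<times> nat \<times> nat \<Rightarrow> (nat + nat) graph" where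
  "p4 = (\<lambda>(x, y, x', y').
     ({Inr y', Inl x, Inr y, Inl x'}, {bedge x y', bedge x y, bedge x' y}))"

lemma mem_quads:
  "(x, y, x', y') \<in> quads n \<longleftrightarrow> x < n \<and> y < n \<and> x' < n \<and> y' < n \<and> x' \<noteq> x \<and> y' \<noteq> y"
  by (auto simp: quads_def)

lemma finite_quads: "finite (quads n)"
  by (auto simp: quads_def)

lemma card_quads: "card (quads n) = n\<^sup>2 * (n - 1)\<^sup>2"
  by (simp add: quads_def card_cartesian_product power2_eq_square)

text \<open>As cells of a grid, the three edges form an L with corner \<open>(x, y)\<close>. The
  corner is the only cell that shares its row with one of the others and its column with the other,
  so the edge set determines the quadruple.\<close>

lemma inj_on_p4: "inj_on p4 (quads n)"
proof (rule inj_onI)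
  fix p q assume "p \<in> quads n" "q \<in> quads n" and eq: "p4 p = p4 q"
  obtain x y x' y' where p: "p = (x, y, x', y')"
    by (metis prod_cases4)
  obtain u v u' v' where q: "q = (u, v, u', v')"
    by (metis prod_cases4)
  have ne: "x' \<noteq> x" "y' \<noteq> y" "u' \<noteq> u" "v' \<noteq> v"
    using \<open>p \<in> quads n\<close> \<open>q \<in> quads n\<close> by (auto simp: p q mem_quads)
  have edges: "{bedge x y', bedge x y, bedge x' y} = {bedge u v', bedge u v, bedge u' v}"
    using eq by (simp add: p4_def p q)
  have mem: "(i, j) \<in> {(x, y'), (x, y), (x', y)} \<longleftrightarrow> (i, j) \<in> {(u, v'), (u, v), (u', v)}" for i j
  proof -
    have "bedge i j \<in> {bedge x y', bedge x y, bedge x' y} \<longleftrightarrow>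
        bedge i j \<in> {bedge u v', bedge u v, bedge u' v}"
      using edges by simp
    then show ?thesis
      by (simp add: bedge_eq_iff)
  qed
  show "p = q"
    using mem[of x y] mem[of x y'] mem[of x' y] mem[of u v] mem[of u v'] mem[of u' v] ne
    unfolding p q by auto
qed

lemma simple_graph_p4:
  assumes "q \<in> quads n"
  shows "simple_graph (p4 q)"
  using assms by (cases q) (auto simp: p4_def simple_graph_def)

lemma copies_path_graph_4:
  "copies (path_graph 4) (complete_bipartite n n) = p4 ` quads n"
proof (intro subset_antisym subsetI)
  fix F assume "F \<in> copies (path_graph 4) (complete_bipartite n n)"
  then have F: "simple_graph F" "edges F \<subseteq> edges (complete_bipartite n n)"
    "isomorphic (path_graph 4) F"
    by (auto simp: copies_def subgraph_def)
  from F(3)[unfolded isomorphic_path_graph_4_iff[OF F(1)]]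
  obtain a b c d where dist: "distinct [a, b, c, d]"
    and Feq: "F = ({a, b, c, d}, {{a, b}, {b, c}, {c, d}})"
    by blast
  have e: "\<exists>i<n. \<exists>j<n. {u, v} = bedge i j" if "{u, v} \<in> edges F" for u v
    using subsetD[OF F(2) that] by (auto simp: complete_bipartite_def)
  have "{a, b} \<in> edges F" "{b, c} \<in> edges F" "{c, d} \<in> edges F"
    by (auto simp: Feq)
  note ee = e[OF this(1)] e[OF this(2)] e[OF this(3)]
  \<comment> \<open>Sides alternate along the path, so exactly one end is a right vertex, and a
    quadruple reads the path from that end. If \<open>b\<close> is a right vertex, this end is
    \<open>d\<close> and the path is read backwards.\<close>
  show "F \<in> p4 ` quads n"
  proof (cases b)
    case (Inl x)
    then obtain y y' x' where "c = Inr y" "a = Inr y'" "d = Inl x'" "x < n" "y < n" "x' < n" "y' < n"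
      using ee by (auto simp: doubleton_eq_iff)
    then have "F = p4 (x, y, x', y')" "(x, y, x', y') \<in> quads n"
      using dist Inl by (auto simp: Feq p4_def mem_quads)
    then show ?thesis
      by blast
  next
    case (Inr y)
    then obtain x y' x' where "c = Inl x" "a = Inl x'" "d = Inr y'" "x < n" "y < n" "x' < n" "y' < n"
      using ee by (auto simp: doubleton_eq_iff)
    then have "F = p4 (x, y, x', y')" "(x, y, x', y') \<in> quads n"
      using dist Inr by (auto simp: Feq p4_def mem_quads)
    then show ?thesis
      by blast
  qed
next
  fix F assume "F \<in> p4 ` quads n"
  then obtain x y x' y' where F: "F = p4 (x, y, x', y')" and q: "(x, y, x', y') \<in> quads n"
    by (metis (no_types) imageE prod_cases4)
  have "subgraph F (complete_bipartite n n)"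
    using q simple_graph_p4[OF q] by (auto simp: F subgraph_def p4_def mem_quads complete_bipartite_def)
  moreover have "isomorphic (path_graph 4) F"
    using q unfolding F isomorphic_path_graph_4_iff[OF simple_graph_p4[OF q]]
    by (intro exI[of _ "Inr y'"] exI[of _ "Inl x"] exI[of _ "Inr y"] exI[of _ "Inl x'"])
      (auto simp: p4_def mem_quads)
  ultimately show "F \<in> copies (path_graph 4) (complete_bipartite n n)"
    by (simp add: copies_def)
qed

lemma rainbow_p4_iff:
  assumes "(x, y, x', y') \<in> quads n"
  shows "rainbow c (p4 (x, y, x', y')) \<longleftrightarrow>
    c (bedge x y') \<noteq> c (bedge x y) \<and> c (bedge x y) \<noteq> c (bedge x' y) \<and>
    c (bedge x y') \<noteq> c (bedge x' y)"
  using assms by (auto simp: rainbow_def p4_def mem_quads inj_on_def bedge_eq_iff)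

definition nonrainbow_quads :: "nat \<Rightarrow> ((nat + nat) set \<Rightarrow> nat) \<Rightarrow> (nat \<times> nat \<times> nat \<times> nat) set" where
  "nonrainbow_quads n c = {q \<in> quads n. \<not> rainbow c (p4 q)}"

text \<open>Minimizing rainbow copies becomes maximizing non-rainbow quadruples. The sum form avoids
  truncated subtraction.\<close>

lemma card_rainbow_copies:
  "card {F \<in> copies (path_graph 4) (complete_bipartite n n). rainbow c F}
     + card (nonrainbow_quads n c) = n\<^sup>2 * (n - 1)\<^sup>2"
proof -
  have "{F \<in> copies (path_graph 4) (complete_bipartite n n). rainbow c F}
      = p4 ` {q \<in> quads n. rainbow c (p4 q)}"
    by (auto simp: copies_path_graph_4)
  then have "card {F \<in> copies (path_graph 4) (complete_bipartite n n). rainbow c F}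
      = card {q \<in> quads n. rainbow c (p4 q)}"
    by (simp add: card_image inj_on_subset[OF inj_on_p4[of n]])
  moreover have "card (quads n) =
      card {q \<in> quads n. rainbow c (p4 q)} + card (nonrainbow_quads n c)"
    unfolding nonrainbow_quads_def
    by (subst card_Un_disjoint[symmetric]) (auto simp: finite_quads intro!: arg_cong[where f = card])
  ultimately show ?thesis
    by (simp add: card_quads)
qed

subsection \<open>Colorings with two fewer colors than edges\<close>

text \<open>The order lets a pair record which of its edges plays which role in a path; three
  unordered pairs count as six.\<close>

definition mono_pairs :: "('a \<Rightarrow> 'b) \<Rightarrow> 'a set \<Rightarrow> ('a \<times> 'a) set" where
  "mono_pairs d E = {(e, f). e \<in> E \<and> f \<in> E \<and> e \<noteq> f \<and> d e = d f}"

lemma finite_mono_pairs: "finite E \<Longrightarrow> finite (mono_pairs d E)"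
  by (rule finite_subset[of _ "E \<times> E"]) (auto simp: mono_pairs_def)

text \<open>With one representative per color in \<open>R\<close>, two elements \<open>a\<close>,
  \<open>b\<close> remain. A monochromatic pair contains \<open>a\<close> or \<open>b\<close>, and
  its partner is the other leftover or the unique representative of the same color. Only three
  unordered pairs are possible.\<close>

lemma card_mono_pairs_le:
  assumes "finite E" "card (d ` E) + 2 = card E"
  shows "card (mono_pairs d E) \<le> 6"
proof -
  obtain R where R: "R \<subseteq> E" "inj_on d R" "d ` E = d ` R"
    using subset_image_inj[of "d ` E" d E] by auto
  have "card (E - R) = 2"
    using assms R by (simp add: card_Diff_subset finite_subset card_image)
  then obtain a b where ab: "E - R = {a, b}"
    by (auto simp: card_2_iff)
  then have "d a \<in> d ` R" "d b \<in> d ` R"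
    using R(3) by blast+
  then obtain a' b' where a': "a' \<in> R" "d a' = d a" and b': "b' \<in> R" "d b' = d b"
    by (elim imageE) metis
  have "mono_pairs d E \<subseteq> set [(a, b), (b, a), (a, a'), (a', a), (b, b'), (b', b)]"
  proof
    fix p assume "p \<in> mono_pairs d E"
    then obtain e f where p: "p = (e, f)" and ef: "e \<in> E" "f \<in> E" "e \<noteq> f" "d e = d f"
      by (auto simp: mono_pairs_def)
    have "e \<in> R \<or> e = a \<or> e = b" "f \<in> R \<or> f = a \<or> f = b"
      using ef ab by blast+
    moreover have "\<not> (e \<in> R \<and> f \<in> R)"
      using ef R(2) by (auto dest: inj_onD)
    moreover have "u = a'" if "u \<in> R" "d u = d a" for u
      using that a' R(2) by (metis inj_onD)
    moreover have "u = b'" if "u \<in> R" "d u = d b" for u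
      using that b' R(2) by (metis inj_onD)
    ultimately show "p \<in> set [(a, b), (b, a), (a, a'), (a', a), (b, b'), (b', b)]"
      using ef(3,4) unfolding p by auto
  qed
  then have "card (mono_pairs d E) \<le> card (set [(a, b), (b, a), (a, a'), (a', a), (b, b'), (b', b)])"
    by (intro card_mono) auto
  also have "\<dots> \<le> 6"
    using card_length[of "[(a, b), (b, a), (a, a'), (a', a), (b, b'), (b', b)]"] by simp
  finally show ?thesis .
qed

text \<open>Each non-rainbow quadruple is charged to an ordered pair of equally colored edges in it.
  Two edges meeting in a vertex fix all but one end of the path, which leaves \<open>n - 1\<close>
  choices; two disjoint edges fix the path completely.\<close>

lemma card_nonrainbow_quads_le:
  assumes "n \<ge> 2"
    and "card (mono_pairs (\<lambda>(i, j). c (bedge i j)) ({..<n} \<times> {..<n})) \<le> m"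
  shows "card (nonrainbow_quads n c) \<le> m * (n - 1)"
proof -
  define M where "M = mono_pairs (\<lambda>(i, j). c (bedge i j)) ({..<n} \<times> {..<n})"
  \<comment> \<open>The monochromatic pairs split into those with a common left vertex, those with a
    common right vertex, and the disjoint ones.\<close>
  define MH where "MH = {((x, y'), (u, y)) \<in> M. x = u}"
  define MV where "MV = {((x, y), (x', v)) \<in> M. y = v}"
  define MD where "MD = {((x, y'), (x', y)) \<in> M. x \<noteq> x' \<and> y \<noteq> y'}"
  have fin: "finite M"
    unfolding M_def by (rule finite_mono_pairs) simp
  have sub: "MH \<subseteq> M" "MV \<subseteq> M" "MD \<subseteq> M"
    by (auto simp: MH_def MV_def MD_def)
  then have fins: "finite MH" "finite MV" "finite MD"
    using fin by (auto intro: finite_subset)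
  define A where "A = (\<lambda>(((x, y'), (u, y)), x'). (x, y, x', y')) `
      (SIGMA p:MH. {..<n} - {fst (fst p)})"
  define B where "B = (\<lambda>(((x, y), (x', v)), y'). (x, y, x', y')) `
      (SIGMA p:MV. {..<n} - {snd (fst p)})"
  define C where "C = (\<lambda>((x, y'), (x', y)). (x, y, x', y')) ` MD"
  have cA: "card A \<le> card MH * (n - 1)"
  proof -
    have "card A \<le> card (SIGMA p:MH. {..<n} - {fst (fst p)})"
      unfolding A_def by (intro card_image_le) (use fins in auto)
    also have "\<dots> = (\<Sum>p\<in>MH. n - 1)"
      unfolding card_SigmaI[OF fins(1), of "\<lambda>p. {..<n} - {fst (fst p)}", simplified]
      using sub(1) by (intro sum.cong) (auto simp: M_def mono_pairs_def)
    finally show ?thesis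
      by simp
  qed
  have cB: "card B \<le> card MV * (n - 1)"
  proof -
    have "card B \<le> card (SIGMA p:MV. {..<n} - {snd (fst p)})"
      unfolding B_def by (intro card_image_le) (use fins in auto)
    also have "\<dots> = (\<Sum>p\<in>MV. n - 1)"
      unfolding card_SigmaI[OF fins(2), of "\<lambda>p. {..<n} - {snd (fst p)}", simplified]
      using sub(2) by (intro sum.cong) (auto simp: M_def mono_pairs_def)
    finally show ?thesis
      by simp
  qed
  have "card C \<le> card MD"
    unfolding C_def using fins(3) by (rule card_image_le)
  \<comment> \<open>Since \<open>n - 1\<close> is at least 1, disjoint pairs obey the same bound as
    adjacent ones.\<close>
  also have "\<dots> \<le> card MD * (n - 1)"
    using assms(1) by (cases "n - 1") auto
  finally have cC: "card C \<le> card MD * (n - 1)" .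
  have "nonrainbow_quads n c \<subseteq> A \<union> B \<union> C"
  proof
    fix q assume "q \<in> nonrainbow_quads n c"
    then obtain x y x' y' where q: "q = (x, y, x', y')" "(x, y, x', y') \<in> quads n"
      and nr: "\<not> rainbow c (p4 (x, y, x', y'))"
      unfolding nonrainbow_quads_def by (metis (no_types, lifting) mem_Collect_eq prod_cases4)
    have less: "x < n" "y < n" "x' < n" "y' < n" "x' \<noteq> x" "y' \<noteq> y"
      using q(2) by (auto simp: mem_quads)
    consider "c (bedge x y') = c (bedge x y)" | "c (bedge x y) = c (bedge x' y)"
      | "c (bedge x y') = c (bedge x' y)"
      using nr rainbow_p4_iff[OF q(2)] by blast
    then show "q \<in> A \<union> B \<union> C"
    proof cases
      case 1
      then have "(((x, y'), (x, y)), x') \<in> (SIGMA p:MH. {..<n} - {fst (fst p)})"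
        using less by (auto simp: MH_def M_def mono_pairs_def)
      then have "q \<in> A"
        unfolding A_def q(1) by (rule rev_image_eqI) simp
      then show ?thesis
        by blast
    next
      case 2
      then have "(((x, y), (x', y)), y') \<in> (SIGMA p:MV. {..<n} - {snd (fst p)})"
        using less by (auto simp: MV_def M_def mono_pairs_def)
      then have "q \<in> B"
        unfolding B_def q(1) by (rule rev_image_eqI) simp
      then show ?thesis
        by blast
    next
      case 3
      then have "((x, y'), (x', y)) \<in> MD"
        using less by (auto simp: MD_def M_def mono_pairs_def)
      then have "q \<in> C"
        unfolding C_def q(1) by (rule rev_image_eqI) simp
      then show ?thesis
        by blast
    qed
  qed
  then have "card (nonrainbow_quads n c) \<le> card (A \<union> B \<union> C)"
    by (intro card_mono) (use fins in \<open>auto simp: A_def B_def C_def\<close>)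
  also have "\<dots> \<le> card A + card B + card C"
    using card_Un_le[of "A \<union> B" C] card_Un_le[of A B] by linarith
  also have "\<dots> \<le> (card MH + card MV + card MD) * (n - 1)"
    using cA cB cC by (simp add: distrib_right)
  also have "card MH + card MV + card MD = card (MH \<union> MV \<union> MD)"
  proof -
    have "MH \<inter> MV = {}" "(MH \<union> MV) \<inter> MD = {}"
      by (auto simp: MH_def MV_def MD_def M_def mono_pairs_def)
    then show ?thesis
      using fins by (simp add: card_Un_disjoint)
  qed
  also have "\<dots> * (n - 1) \<le> m * (n - 1)"
    using card_mono[OF fin, of "MH \<union> MV \<union> MD"] sub assms(2) by (simp add: M_def[symmetric])
  finally show ?thesis .
qed

text \<open>The elements of \<open>S\<close> contribute one color and those outside \<open>S\<close>
  at most \<open>card E - card S\<close>, so the total can reach \<open>card E - 2\<close> only if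
  \<open>card S\<close> is at most 3.\<close>

lemma color_class_le_3:
  assumes "finite E" "card (c ` E) + 2 = card E" "S \<subseteq> E" "\<forall>e\<in>S. \<forall>f\<in>S. c e = c f"
  shows "card S \<le> 3"
proof (rule ccontr)
  assume "\<not> card S \<le> 3"
  then have S: "card S \<ge> 4" "S \<noteq> {}"
    by auto
  then obtain s where s: "s \<in> S"
    by blast
  have "c ` E \<subseteq> insert (c s) (c ` (E - S))"
    using assms(4) s by blast
  then have "card (c ` E) \<le> card (insert (c s) (c ` (E - S)))"
    using assms(1) by (intro card_mono) auto
  also have "\<dots> \<le> Suc (card (c ` (E - S)))"
    by (rule card_insert_le_m1) simp_all
  also have "\<dots> \<le> Suc (card (E - S))"
    using assms(1) by (simp add: card_image_le)
  also have "\<dots> = Suc (card E - card S)"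
    using assms(1,3) by (simp add: card_Diff_subset finite_subset)
  finally show False
    using assms(2) S(1) card_mono[OF assms(1,3)] by linarith
qed

text \<open>A map injective on vertices is injective on edges as vertex sets. This carries the lower
  bound on the edges of \<open>H\<close> over to its copies.\<close>

lemma isomorphic_card_edges_le:
  assumes "simple_graph H" "finite (edges F)" "isomorphic H F"
  shows "card (edges H) \<le> card (edges F)"
proof -
  obtain f where f: "bij_betw f (verts H) (verts F)"
    "\<forall>u\<in>verts H. \<forall>v\<in>verts H. {u, v} \<in> edges H \<longleftrightarrow> {f u, f v} \<in> edges F"
    using assms(3) unfolding isomorphic_def by blast
  have "inj_on ((`) f) (edges H)"
    using assms(1) f(1) unfolding simple_graph_def bij_betw_def
    by (intro inj_onI) (metis inj_on_image_eq_iff)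
  moreover have "(`) f ` edges H \<subseteq> edges F"
  proof (clarify)
    fix e assume e: "e \<in> edges H"
    then obtain u v where "e = {u, v}" "u \<in> verts H" "v \<in> verts H"
      using assms(1) by (auto elim: simple_graph_edgeE)
    then show "f ` e \<in> edges F"
      using f(2) e by auto
  qed
  ultimately show ?thesis
    using assms(2) by (rule card_inj_on_le)
qed

subsection \<open>The Gallai-Ramsey number\<close>

text \<open>Read \<open>d\<close> as a matrix. If some row \<open>x\<close> has three colors,
  comparing another row with it at differently colored entries forces equality, so columns are
  constant. If row \<open>x\<close> has exactly two colors, they are the only ones in the
  matrix.\<close>

lemma no_rainbow_P4_cases:
  assumes free: "\<forall>x\<in>X. \<forall>y\<in>Y. \<forall>x'\<in>X. \<forall>y'\<in>Y. x' \<noteq> x \<longrightarrow> y' \<noteq> y \<longrightarrow>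
      d x y' = d x y \<or> d x y = d x' y \<or> d x y' = d x' y"
  obtains (rows) "\<forall>x\<in>X. \<forall>y\<in>Y. \<forall>y'\<in>Y. d x y = d x y'"
    | (columns) "\<forall>y\<in>Y. \<forall>x\<in>X. \<forall>x'\<in>X. d x y = d x' y"
    | (two_colors) a b where "\<forall>x\<in>X. \<forall>y\<in>Y. d x y \<in> {a, b}"
proof (cases "\<forall>x\<in>X. \<forall>y\<in>Y. \<forall>y'\<in>Y. d x y = d x y'")
  case True
  then show ?thesis
    by (rule rows)
next
  case False
  then obtain x y1 y2 where x: "x \<in> X" "y1 \<in> Y" "y2 \<in> Y" "d x y1 \<noteq> d x y2"
    by blast
  \<comment> \<open>This is the path \<open>y' - x - y - x'\<close>: its first two edges differ in
    color, so the third repeats one of them.\<close>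
  have step: "d x' y \<in> {d x y, d x y'}" if "x' \<in> X" "y \<in> Y" "y' \<in> Y" "d x y \<noteq> d x y'" for x' y y'
    using free[rule_format, of x y x' y'] x that by (cases "x' = x"; cases "y' = y") auto
  show ?thesis
  proof (cases "\<forall>y\<in>Y. d x y \<in> {d x y1, d x y2}")
    case True
    have "d x' y \<in> {d x y1, d x y2}" if "x' \<in> X" "y \<in> Y" for x' y
      using step[of x' y y1] step[of x' y y2] True x that by fastforce
    then show ?thesis
      using two_colors by blast
  next
    case False
    then obtain y3 where y3: "y3 \<in> Y" "d x y3 \<noteq> d x y1" "d x y3 \<noteq> d x y2"
      by blast
    \<comment> \<open>Two of \<open>y1\<close>, \<open>y2\<close>, \<open>y3\<close> differ in color
      from \<open>y\<close> in row \<open>x\<close> and from each other; the two resulting sets from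
      \<open>step\<close> meet only in \<open>d x y\<close>.\<close>
    have "d x' y = d x y" if "x' \<in> X" "y \<in> Y" for x' y
      using step[of x' y y1] step[of x' y y2] step[of x' y y3] x y3 that by fastforce
    then show ?thesis
      using columns by (metis x(1))
  qed
qed

text \<open>Without isolated vertices, \<open>verts H\<close> is the union of the edges; since there
  is an edge, the center \<open>Inl 0\<close> belongs to it.\<close>

lemma star_structure:
  assumes "subgraph H (complete_bipartite 1 m)" "edges H \<noteq> {}"
  obtains J where "J \<subseteq> {..<m}" "verts H = insert (Inl 0) (Inr ` J)" "edges H = bedge 0 ` J"
proof
  let ?J = "{j. bedge 0 j \<in> edges H}"
  have H: "simple_graph H" "edges H \<subseteq> edges (complete_bipartite 1 m)"
    using assms(1) by (auto simp: subgraph_def)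
  show "?J \<subseteq> {..<m}"
    using H(2) by (auto simp: complete_bipartite_def bedge_eq_iff)
  show E: "edges H = bedge 0 ` ?J"
    using H(2) by (auto simp: complete_bipartite_def)
  have "verts H = \<Union> (edges H)"
    using H(1) unfolding simple_graph_def by blast
  also have "\<dots> = insert (Inl 0) (Inr ` ?J)"
  proof -
    have "\<Union> (bedge 0 ` J) = insert (Inl 0) (Inr ` J)" if "J \<noteq> {}" for J
      using that by auto
    moreover have "?J \<noteq> {}"
      using E assms(2) by auto
    ultimately show ?thesis
      using E by metis
  qed
  finally show "verts H = insert (Inl 0) (Inr ` ?J)" .
qed

lemma finite_subgraph_edges: "subgraph H (complete_bipartite m n) \<Longrightarrow> finite (edges H)"
  unfolding subgraph_def by (meson finite_edges_complete_bipartite finite_subset)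

text \<open>The center moves to \<open>Inl x\<close> and the leaves stay; they fit because
  \<open>m\<close> is at most \<open>n\<close>.\<close>

lemma mono_star_copy_left:
  assumes H: "subgraph H (complete_bipartite 1 m)" "edges H \<noteq> {}"
    and "m \<le> n" "x < n" and mono: "\<forall>y<n. \<forall>y'<n. c (bedge x y) = c (bedge x y')"
  shows "\<exists>F\<in>copies H (complete_bipartite n n). monochromatic c F"
proof -
  obtain J where J: "J \<subseteq> {..<m}" "verts H = insert (Inl 0) (Inr ` J)" "edges H = bedge 0 ` J"
    using star_structure[OF H] .
  define F :: "(nat + nat) graph" where "F = (insert (Inl x) (Inr ` J), bedge x ` J)"
  have "J \<noteq> {}" "finite J"
    using J H(2) by (auto intro: finite_subset)
  then have "subgraph F (complete_bipartite n n)"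
    using J(1) assms(3,4) by (auto simp: F_def subgraph_def simple_graph_def complete_bipartite_def
        bedge_eq_iff)
  moreover have "isomorphic H F"
    unfolding isomorphic_def J F_def
    by (rule exI[of _ "case_sum (\<lambda>_. Inl x) Inr"])
      (auto simp: bij_betw_def inj_on_def doubleton_eq_iff image_image)
  moreover have "monochromatic c F"
  proof -
    have "j < n" if "j \<in> J" for j
      using that J(1) assms(3) by fastforce
    then show ?thesis
      by (auto simp: monochromatic_def F_def intro!: mono[rule_format])
  qed
  ultimately show ?thesis
    unfolding copies_def by blast
qed

text \<open>Mirror image of the previous lemma: the center moves to the right side, so the leaves
  change sides as well.\<close>

lemma mono_star_copy_right:
  assumes H: "subgraph H (complete_bipartite 1 m)" "edges H \<noteq> {}"
    and "m \<le> n" "y < n" and mono: "\<forall>x<n. \<forall>x'<n. c (bedge x y) = c (bedge x' y)"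
  shows "\<exists>F\<in>copies H (complete_bipartite n n). monochromatic c F"
proof -
  obtain J where J: "J \<subseteq> {..<m}" "verts H = insert (Inl 0) (Inr ` J)" "edges H = bedge 0 ` J"
    using star_structure[OF H] .
  define F :: "(nat + nat) graph" where "F = (insert (Inr y) (Inl ` J), (\<lambda>x. bedge x y) ` J)"
  have "J \<noteq> {}" "finite J"
    using J H(2) by (auto intro: finite_subset)
  then have "subgraph F (complete_bipartite n n)"
    using J(1) assms(3,4) by (auto simp: F_def subgraph_def simple_graph_def complete_bipartite_def
        bedge_eq_iff)
  moreover have "isomorphic H F"
    unfolding isomorphic_def J F_def
    by (rule exI[of _ "case_sum (\<lambda>_. Inr y) Inl"])
      (auto simp: bij_betw_def inj_on_def doubleton_eq_iff image_image)
  moreover have "monochromatic c F"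
  proof -
    have "j < n" if "j \<in> J" for j
      using that J(1) assms(3) by fastforce
    then show ?thesis
      by (auto simp: monochromatic_def F_def intro!: mono[rule_format])
  qed
  ultimately show ?thesis
    unfolding copies_def by blast
qed

text \<open>If every row is constant, the \<open>m\<close> colors need at least \<open>m\<close>
  rows, so a row is long enough for a star with \<open>m\<close> leaves; likewise for columns. Three
  colors exclude the remaining case.\<close>

lemma rainbow_P4_or_mono_star:
  assumes H: "subgraph H (complete_bipartite 1 m)" "edges H \<noteq> {}"
    and "m \<ge> 3" and c: "exact_coloring m (complete_bipartite n n) c"
  shows "(\<exists>F\<in>copies (path_graph 4) (complete_bipartite n n). rainbow c F) \<or>
    (\<exists>F\<in>copies H (complete_bipartite n n). monochromatic c F)"
proof (rule disj_imp[THEN iffD2], rule impI)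
  assume nr: "\<not> (\<exists>F\<in>copies (path_graph 4) (complete_bipartite n n). rainbow c F)"
  define d where "d x y = c (bedge x y)" for x y
  have im: "{1..m} = (\<lambda>(x, y). d x y) ` ({..<n} \<times> {..<n})"
    using c unfolding exact_coloring_def edges_complete_bipartite
    by (auto simp: d_def image_image split_def)
  then have "n \<noteq> 0"
    using \<open>m \<ge> 3\<close> by (intro notI) auto
  have "\<forall>x\<in>{..<n}. \<forall>y\<in>{..<n}. \<forall>x'\<in>{..<n}. \<forall>y'\<in>{..<n}. x' \<noteq> x \<longrightarrow> y' \<noteq> y \<longrightarrow>
      d x y' = d x y \<or> d x y = d x' y \<or> d x y' = d x' y"
  proof (intro ballI impI)
    fix x y x' y'
    assume "x \<in> {..<n}" "y \<in> {..<n}" "x' \<in> {..<n}" "y' \<in> {..<n}" "x' \<noteq> x" "y' \<noteq> y"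
    then have "(x, y, x', y') \<in> quads n"
      by (simp add: mem_quads)
    then show "d x y' = d x y \<or> d x y = d x' y \<or> d x y' = d x' y"
      using nr rainbow_p4_iff[of x y x' y' n c] unfolding copies_path_graph_4 d_def by blast
  qed
  then consider (rows) "\<forall>x\<in>{..<n}. \<forall>y\<in>{..<n}. \<forall>y'\<in>{..<n}. d x y = d x y'"
    | (columns) "\<forall>y\<in>{..<n}. \<forall>x\<in>{..<n}. \<forall>x'\<in>{..<n}. d x y = d x' y"
    | (two_colors) a b where "\<forall>x\<in>{..<n}. \<forall>y\<in>{..<n}. d x y \<in> {a, b}"
    by (rule no_rainbow_P4_cases)
  then show "\<exists>F\<in>copies H (complete_bipartite n n). monochromatic c F"
  proof cases
    case rows
    \<comment> \<open>Column 0 already shows every color, hence at most \<open>n\<close> colors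
      occur.\<close>
    have "d x y \<in> (\<lambda>x. d x 0) ` {..<n}" if "x < n" "y < n" for x y
      using rows[rule_format, of x y 0] that by (intro image_eqI[of _ _ x]) simp_all
    then have "{1..m} \<subseteq> (\<lambda>x. d x 0) ` {..<n}"
      unfolding im by (intro image_subsetI, elim SigmaE) (simp only: case_prod_conv lessThan_iff)
    then have "m \<le> n"
      using surj_card_le[of "{..<n}" "{1..m}" "\<lambda>x. d x 0"] by simp
    then show ?thesis
      using \<open>n \<noteq> 0\<close>
      by (intro mono_star_copy_left[OF H, of n 0])
        (auto simp: d_def[symmetric] intro!: rows[rule_format])
  next
    case columns
    have "d x y \<in> (\<lambda>y. d 0 y) ` {..<n}" if "x < n" "y < n" for x y
      using columns[rule_format, of y x 0] that by (intro image_eqI[of _ _ y]) simp_all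
    then have "{1..m} \<subseteq> (\<lambda>y. d 0 y) ` {..<n}"
      unfolding im by (intro image_subsetI, elim SigmaE) (simp only: case_prod_conv lessThan_iff)
    then have "m \<le> n"
      using surj_card_le[of "{..<n}" "{1..m}" "\<lambda>y. d 0 y"] by simp
    then show ?thesis
      using \<open>n \<noteq> 0\<close>
      by (intro mono_star_copy_right[OF H, of n 0])
        (auto simp: d_def[symmetric] intro!: columns[rule_format])
  next
    case (two_colors a b)
    then have "{1..m} \<subseteq> {a, b}"
      unfolding im by auto
    then have "card {1..m} \<le> card {a, b}"
      by (intro card_mono) auto
    also have "\<dots> \<le> 2"
      by (simp add: card_insert_if)
    finally show ?thesis
      using \<open>m \<ge> 3\<close> by simp
  qed
qed

text \<open>The edges from left vertex 0 to right vertices 0, 1, 2 share a color and all other edges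
  have a color of their own. The three pairs in this star are all adjacent, which makes the charging
  bound sharp.\<close>

lemma extremal_coloring:
  assumes "t \<ge> 3"
  obtains c where "exact_coloring (t\<^sup>2 - 2) (complete_bipartite t t) c"
    "card (nonrainbow_quads t c) \<ge> 6 * (t - 1)"
proof -
  let ?E = "{..<t} \<times> {..<t}"
  let ?E' = "?E - {(0, 1), (0, 2)}"
  have "card ?E' = card {1..t\<^sup>2 - 2}"
    using assms by (simp add: card_Diff_subset power2_eq_square)
  then obtain g where g: "bij_betw g ?E' {1..t\<^sup>2 - 2}"
    by (metis finite_Diff finite_SigmaI finite_atLeastAtMost finite_lessThan finite_same_card_bij)
  define d where "d p = (if p \<in> {(0, 1), (0, 2)} then g (0, 0) else g p)" for p
  \<comment> \<open>Colorings act on vertex sets, so the cell is recovered from its edge by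
    \<open>THE\<close>.\<close>
  define c where "c e = d (THE p. e = (case p of (i, j) \<Rightarrow> bedge i j))" for e
  have c: "c (bedge i j) = d (i, j)" for i j
  proof -
    have "(THE p. bedge i j = (case p of (i, j) \<Rightarrow> bedge i j)) = (i, j)"
      by (rule the_equality) (auto simp: bedge_eq_iff)
    then show ?thesis
      by (simp add: c_def)
  qed
  have "d ` ?E = g ` ?E'"
  proof -
    have "?E = ?E' \<union> {(0, 1), (0, 2)}"
      using assms by auto
    then have "d ` ?E = d ` ?E' \<union> d ` {(0, 1), (0, 2)}"
      by (metis image_Un)
    also have "d ` {(0, 1), (0, 2)} = {g (0, 0)}"
      by (auto simp: d_def)
    also have "d ` ?E' = g ` ?E'"
      by (intro image_cong) (auto simp: d_def)
    also have "g ` ?E' \<union> {g (0, 0)} = g ` ?E'"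
      using assms by auto
    finally show ?thesis .
  qed
  then have "exact_coloring (t\<^sup>2 - 2) (complete_bipartite t t) c"
    using bij_betw_imp_surj_on[OF g]
    by (simp add: exact_coloring_def edges_complete_bipartite image_image split_def c)
  moreover have "6 * (t - 1) \<le> card (nonrainbow_quads t c)"
  proof -
    \<comment> \<open>The ordered pairs of distinct leaves of the monochromatic star, used as
      \<open>(y, y')\<close>; the far end \<open>x'\<close> may be any left vertex except the center
      0.\<close>
    let ?P = "{(0, 1), (1, 0), (0, 2), (2, 0), (1, 2), (2, 1)} :: (nat \<times> nat) set"
    let ?f = "\<lambda>((y, y'), x'). (0 :: nat, y, x', y')"
    have "?f ` (?P \<times> {1..<t}) \<subseteq> nonrainbow_quads t c"
    proof clarify
      fix y y' x' :: nat assume yy': "(y, y') \<in> ?P" and "x' \<in> {1..<t}"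
      then have q: "(0, y, x', y') \<in> quads t"
        using assms by (auto simp: mem_quads)
      have "c (bedge 0 y') = g (0, 0)" "c (bedge 0 y) = g (0, 0)"
        using yy' by (auto simp: c d_def)
      then show "(0, y, x', y') \<in> nonrainbow_quads t c"
        using q rainbow_p4_iff[OF q] by (simp add: nonrainbow_quads_def)
    qed
    then have "card (?f ` (?P \<times> {1..<t})) \<le> card (nonrainbow_quads t c)"
      by (intro card_mono) (auto simp: nonrainbow_quads_def finite_quads)
    moreover have "inj_on ?f (?P \<times> {1..<t})"
      by (auto simp: inj_on_def)
    then have "card (?f ` (?P \<times> {1..<t})) = card (?P \<times> {1..<t})"
      by (rule card_image)
    moreover have "card (?P \<times> {1..<t}) = 6 * (t - 1)"
      by (simp add: card_cartesian_product)
    ultimately show ?thesis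
      by simp
  qed
  ultimately show ?thesis
    by (rule that)
qed

text \<open>The previous alternative holds for every \<open>n\<close>, so only the existence of an
  exact coloring bounds \<open>N\<close> from below.\<close>

lemma bgr_P4_star:
  assumes "t \<ge> 3" "subgraph H (complete_bipartite 1 (t\<^sup>2 - 2))" "edges H \<noteq> {}"
  shows "bgr (t\<^sup>2 - 2) (path_graph 4) H = t"
  unfolding bgr_def
proof (rule Least_equality, intro conjI)
  have "t\<^sup>2 \<ge> 9"
    using power_mono[OF assms(1), of 2] by simp
  then show "\<forall>n\<ge>t. \<forall>c. exact_coloring (t\<^sup>2 - 2) (complete_bipartite n n) c \<longrightarrow>
      (\<exists>F\<in>copies (path_graph 4) (complete_bipartite n n). rainbow c F) \<or>
      (\<exists>F\<in>copies H (complete_bipartite n n). monochromatic c F)"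
    using rainbow_P4_or_mono_star[OF assms(2,3)] by simp
  show "\<exists>c. exact_coloring (t\<^sup>2 - 2) (complete_bipartite t t) c"
    using extremal_coloring[OF assms(1)] by metis
next
  fix N
  assume "(\<exists>c. exact_coloring (t\<^sup>2 - 2) (complete_bipartite N N) c) \<and>
     (\<forall>n\<ge>N. \<forall>c. exact_coloring (t\<^sup>2 - 2) (complete_bipartite n n) c \<longrightarrow>
        (\<exists>F\<in>copies (path_graph 4) (complete_bipartite n n). rainbow c F) \<or>
        (\<exists>F\<in>copies H (complete_bipartite n n). monochromatic c F))"
  then obtain c where c: "c ` edges (complete_bipartite N N) = {1..t\<^sup>2 - 2}"
    by (auto simp: exact_coloring_def)
  have "t\<^sup>2 - 2 \<le> N * N"
    using card_image_le[OF finite_edges_complete_bipartite, of c N N]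
    by (simp add: c card_edges_complete_bipartite)
  show "t \<le> N"
  proof (rule ccontr)
    assume "\<not> t \<le> N"
    then obtain s where s: "t = Suc s" "N \<le> s"
      by (cases t) auto
    then have "N * N \<le> s * s"
      by (intro mult_mono) auto
    \<comment> \<open>With \<open>s = t - 1\<close> at least 2, \<open>t^2 - 2\<close> exceeds
      \<open>s * s\<close>, so there are too few edges for all colors.\<close>
    moreover have "t\<^sup>2 = s * s + 2 * s + 1"
      by (simp add: s power2_eq_square)
    ultimately show False
      using \<open>t\<^sup>2 - 2 \<le> N * N\<close> assms(1) s(1) by linarith
  qed
qed

subsection \<open>The multiplicity\<close>

lemma no_mono_copies:
  assumes "exact_coloring (t\<^sup>2 - 2) (complete_bipartite t t) c" "t \<ge> 2"
    and "simple_graph H" "card (edges H) \<ge> 4"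
  shows "{F \<in> copies H (complete_bipartite t t). monochromatic c F} = {}"
proof -
  \<comment> \<open>Keeps the natural number subtraction in \<open>t^2 - 2\<close> from
    truncating.\<close>
  have t: "t\<^sup>2 \<ge> 4"
    using power_mono[OF assms(2), of 2] by simp
  have False if F: "F \<in> copies H (complete_bipartite t t)" "monochromatic c F" for F
  proof -
    have "card (c ` edges (complete_bipartite t t)) + 2 = card (edges (complete_bipartite t t))"
      using assms(1) t
      by (simp add: exact_coloring_def card_edges_complete_bipartite power2_eq_square)
    moreover have "edges F \<subseteq> edges (complete_bipartite t t)"
      using F(1) by (simp add: copies_def subgraph_def)
    ultimately have "card (edges F) \<le> 3"
      using F(2) unfolding monochromatic_def
      by (rule color_class_le_3[OF finite_edges_complete_bipartite])
    moreover have "card (edges H) \<le> card (edges F)"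
      using F(1) assms(3)
      by (intro isomorphic_card_edges_le) (auto simp: copies_def dest: finite_subgraph_edges)
    ultimately show False
      using assms(4) by simp
  qed
  then show ?thesis
    by blast
qed

lemma card_nonrainbow_quads_le_6:
  assumes "exact_coloring (t\<^sup>2 - 2) (complete_bipartite t t) c" "t \<ge> 2"
  shows "card (nonrainbow_quads t c) \<le> 6 * (t - 1)"
proof (rule card_nonrainbow_quads_le[OF assms(2)], rule card_mono_pairs_le)
  have "t\<^sup>2 \<ge> 4"
    using power_mono[OF assms(2), of 2] by simp
  moreover have "(\<lambda>(i, j). c (bedge i j)) ` ({..<t} \<times> {..<t}) = {1..t\<^sup>2 - 2}"
    using assms(1) by (simp add: exact_coloring_def edges_complete_bipartite image_image split_def)
  ultimately show "card ((\<lambda>(i, j). c (bedge i j)) ` ({..<t} \<times> {..<t})) + 2 = card ({..<t} \<times> {..<t})"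
    by (simp add: power2_eq_square)
qed simp

theorem theorem4p3:
  fixes k t :: nat and H :: "(nat + nat) graph"
  assumes "k = t\<^sup>2" and "t\<^sup>2 \<ge> 9"
    and "subgraph H (complete_bipartite 1 (k - 2))"
    and "card (edges H) \<ge> 4"
  shows "int (bi_GM (k - 2) (path_graph 4) H) = (int t)\<^sup>2 * (int t - 1)\<^sup>2 - 6 * (int t - 1)"
proof -
  have t: "t \<ge> 3"
    using assms(2) power2_le_imp_le[of 3 t] by simp
  have H: "simple_graph H" "edges H \<noteq> {}"
    using assms(3,4) by (auto simp: subgraph_def)
  have bgr: "bgr (k - 2) (path_graph 4) H = t"
    using bgr_P4_star[OF t _ H(2)] assms(1,3) by simp
  let ?K = "complete_bipartite t t"
  let ?R = "\<lambda>c. card {F \<in> copies (path_graph 4) ?K. rainbow c F}"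
  have no_mono: "card {F \<in> copies H ?K. monochromatic c F} = 0"
    if "exact_coloring (t\<^sup>2 - 2) ?K c" for c
    by (subst no_mono_copies[OF that _ H(1) assms(4)]) (use t in simp_all)
  have "bi_GM (k - 2) (path_graph 4) H =
      (LEAST m. \<exists>c. exact_coloring (t\<^sup>2 - 2) ?K c \<and>
        m = ?R c + card {F \<in> copies H ?K. monochromatic c F})"
    by (simp only: bi_GM_def bgr Let_def) (simp only: assms(1))
  also have "\<dots> = (LEAST m. \<exists>c. exact_coloring (t\<^sup>2 - 2) ?K c \<and> m = ?R c)"
    \<comment> \<open>The congruence rule makes exactness of \<open>c\<close> available when the
      second summand is rewritten to 0.\<close>
    by (simp only: no_mono add_0_right cong: conj_cong)
  also have "\<dots> = t\<^sup>2 * (t - 1)\<^sup>2 - 6 * (t - 1)"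
  proof (rule Least_equality)
    obtain c where c: "exact_coloring (t\<^sup>2 - 2) ?K c" "card (nonrainbow_quads t c) \<ge> 6 * (t - 1)"
      using extremal_coloring[OF t] .
    then have "card (nonrainbow_quads t c) = 6 * (t - 1)"
      using card_nonrainbow_quads_le_6[OF c(1)] t by simp
    then have "t\<^sup>2 * (t - 1)\<^sup>2 - 6 * (t - 1) = ?R c"
      using card_rainbow_copies[of t c] by linarith
    then show "\<exists>c. exact_coloring (t\<^sup>2 - 2) ?K c \<and> t\<^sup>2 * (t - 1)\<^sup>2 - 6 * (t - 1) = ?R c"
      using c(1) by blast
  next
    fix m assume "\<exists>c. exact_coloring (t\<^sup>2 - 2) ?K c \<and> m = ?R c"
    then obtain c where c: "exact_coloring (t\<^sup>2 - 2) ?K c" "m = ?R c"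
      by blast
    then show "t\<^sup>2 * (t - 1)\<^sup>2 - 6 * (t - 1) \<le> m"
      using card_rainbow_copies[of t c] card_nonrainbow_quads_le_6[OF c(1)] t by linarith
  qed
  finally have eq: "bi_GM (k - 2) (path_graph 4) H = t\<^sup>2 * (t - 1)\<^sup>2 - 6 * (t - 1)" .
  \<comment> \<open>The subtraction in \<open>eq\<close> is on naturals; this shows that it does not
    truncate and so agrees with the integer formula.\<close>
  have "6 * (t - 1) \<le> 9 * (t - 1)\<^sup>2"
    using t by (simp add: power2_eq_square)
  also have "\<dots> \<le> t\<^sup>2 * (t - 1)\<^sup>2"
    using assms(2) by simp
  finally show ?thesis
    unfolding eq using t by (simp add: of_nat_diff)
qed

end
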